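(* Let $f:H\to\mathbb{R}$ be $\mu$-strongly convex ($\mu>0$) and twice differentiable, with minimum value $f^*$. Pick $\theta>0$ and let $$\alpha\in\left(0,2\sqrt{\mu\theta}\right],\qquad \beta>0,\qquad \gamma=\theta+\tfrac12\alpha\beta.$$ Let $x:[0,\infty)\to H$ satisfy $$\ddot{x}(t)+\alpha\dot{x}(t)+\beta\nabla^2 f(x(t))\dot{x}(t)+\gamma\nabla f(x(t))=0$$ with $x(0)=x_0$ and $\dot{x}(0)=v_0$. If $v_0=-\beta\nabla f(x_0)$, then for every $t\ge 0$, $$f(x(t))-f^*\le 2\left(f(x_0)-f^*\right)e^{-\frac12\alpha t},$$ and moreover $$\int_0^\infty e^{\frac{\alpha}{2}t}\|\nabla f(x(t))\|^2\,dt<\infty.$$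
   Context: $H$ is a real Hilbert space with inner product $\langle\cdot,\cdot\rangle$ and norm $\|\cdot\|$. The function $f$ attains its minimum $f^*=\min(f)$. A differentiable $f$ is $\mu$-strongly convex if $f(y)\ge f(x)+\langle\nabla f(x),y-x\rangle+\frac{\mu}{2}\|x-y\|^2$ for all $x,y\in H$. *)

theory Defs
  imports "HOL-Analysis.Analysis"
begin

definition gradient :: "('a::real_inner \<Rightarrow> real) \<Rightarrow> 'a \<Rightarrow> 'a" where
  "gradient f x = (THE g. GDERIV f x :> g)"

text \<open>
  On a Hilbert space the Riesz theorem guarantees that \<^const>\<open>gradient\<close> is defined wherever
  the function is Frechet differentiable.
\<close>

lemma riesz_representation:
  fixes L :: "'a::{real_inner, complete_space} \<Rightarrow> real"
  assumes "bounded_linear L"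
  shows "\<exists>g. \<forall>h. L h = h \<bullet> g"
proof -
  interpret L: bounded_linear L by fact
  define J where "J x = (x \<bullet> x) / 2 - L x" for x
  obtain K where K: "\<And>x. \<bar>L x\<bar> \<le> norm x * K"
    using L.bounded by auto
  have lower: "- K\<^sup>2 / 2 \<le> J x" for x
  proof -
    have "0 \<le> (norm x - K)\<^sup>2" by simp
    hence "norm x * K - K\<^sup>2 / 2 \<le> (x \<bullet> x) / 2"
      by (simp add: power2_diff dot_square_norm)
    moreover have "L x \<le> norm x * K" using K[of x] by linarith
    ultimately show ?thesis unfolding J_def by linarith
  qed
  have bdd: "bdd_below (range J)" using lower by (meson bdd_belowI2)
  define m where "m = Inf (range J)"
  have mle: "m \<le> J x" for x unfolding m_def using bdd by (simp add: cInf_lower)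
  have "\<exists>x. J x < m + inverse (real (Suc n))" for n
  proof -
    have "Inf (range J) < m + inverse (real (Suc n))" unfolding m_def by simp
    thus ?thesis using cInf_lessD by blast
  qed
  then obtain X where X: "\<And>n. J (X n) < m + inverse (real (Suc n))" by metis
  have par: "(norm (a - b))\<^sup>2 \<le> 4 * (J a - m) + 4 * (J b - m)" for a b
  proof -
    have "(norm (a - b))\<^sup>2 = 4 * J a + 4 * J b - 8 * J ((1/2) *\<^sub>R (a + b))"
      unfolding J_def power2_norm_eq_inner L.scaleR L.add
      by (simp add: inner_diff inner_add inner_commute algebra_simps add_divide_distrib)
    also have "\<dots> \<le> 4 * J a + 4 * J b - 8 * m"
      using mle by simp
    also have "\<dots> = 4 * (J a - m) + 4 * (J b - m)" by algebra
    finally show ?thesis .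
  qed
  have "Cauchy X"
  proof (rule metric_CauchyI)
    fix e :: real assume "0 < e"
    obtain N where N: "inverse (real (Suc N)) < e\<^sup>2 / 8"
      using reals_Archimedean[of "e\<^sup>2 / 8"] \<open>0 < e\<close> by auto
    have Jn: "J (X n) - m < e\<^sup>2 / 8" if "n \<ge> N" for n
    proof -
      have "inverse (real (Suc n)) \<le> inverse (real (Suc N))"
        using that by (simp add: le_imp_inverse_le)
      thus ?thesis using X[of n] N by linarith
    qed
    have "dist (X p) (X q) < e" if "p \<ge> N" "q \<ge> N" for p q
    proof -
      have "(norm (X p - X q))\<^sup>2 < e\<^sup>2"
        using par[of "X p" "X q"] Jn[OF that(1)] Jn[OF that(2)] by argo
      thus ?thesis using \<open>0 < e\<close> by (simp add: dist_norm power_less_imp_less_base)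
    qed
    thus "\<exists>M. \<forall>p\<ge>M. \<forall>q\<ge>M. dist (X p) (X q) < e" by blast
  qed
  then obtain g where g: "X \<longlonglongrightarrow> g" using Cauchy_convergent convergent_def by blast
  have "(\<lambda>n. J (X n)) \<longlonglongrightarrow> J g"
    unfolding J_def by (intro tendsto_intros L.tendsto g) auto
  moreover have "(\<lambda>n. m + inverse (real (Suc n))) \<longlonglongrightarrow> m + 0"
    by (intro tendsto_intros LIMSEQ_inverse_real_of_nat)
  ultimately have "J g \<le> m + 0"
    by (rule LIMSEQ_le) (use X less_imp_le in blast)
  hence min: "J g \<le> J x" for x using mle[of x] by linarith
  have "L h = h \<bullet> g" for h
  proof -
    define c where "c = h \<bullet> g - L h"
    have key: "0 \<le> t * c + t\<^sup>2 * (h \<bullet> h) / 2" for t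
      using min[of "g + t *\<^sub>R h"] unfolding J_def c_def L.scaleR L.add
      by (simp add: inner_add inner_commute algebra_simps power2_eq_square)
    have "c = 0"
    proof (cases "h = 0")
      case True
      thus ?thesis by (simp add: c_def L.zero)
    next
      case False
      hence "0 < h \<bullet> h" by simp
      have "0 \<le> - (c\<^sup>2 / (h \<bullet> h)) / 2"
        using key[of "- c / (h \<bullet> h)"] \<open>0 < h \<bullet> h\<close>
        by (simp add: power2_eq_square field_simps)
      hence "c\<^sup>2 / (h \<bullet> h) \<le> 0" by simp
      thus ?thesis using \<open>0 < h \<bullet> h\<close> by (simp add: divide_le_0_iff)
    qed
    thus ?thesis by (simp add: c_def)
  qed
  thus ?thesis by blast
qed

lemma GDERIV_unique:
  assumes "GDERIV f x :> g" "GDERIV f x :> g'"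
  shows "g = g'"
proof -
  have "(\<lambda>h. h \<bullet> g) = (\<lambda>h. h \<bullet> g')"
    using assms has_derivative_unique unfolding gderiv_def by blast
  hence "(g - g') \<bullet> g = (g - g') \<bullet> g'" by metis
  hence "(g - g') \<bullet> (g - g') = 0" by (simp add: inner_diff_right)
  thus ?thesis by simp
qed

lemma GDERIV_gradient:
  fixes f :: "'a::{real_inner, complete_space} \<Rightarrow> real"
  assumes "f differentiable (at x)"
  shows "GDERIV f x :> gradient f x"
proof -
  obtain f' where f': "(f has_derivative f') (at x)"
    using assms by (auto simp: differentiable_def)
  then obtain g where "\<And>h. f' h = h \<bullet> g"
    using riesz_representation has_derivative_bounded_linear by blast
  hence "f' = (\<lambda>h. h \<bullet> g)" by blast
  hence "GDERIV f x :> g" using f' by (simp add: gderiv_def)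
  thus ?thesis unfolding gradient_def using GDERIV_unique by (metis theI)
qed

definition twice_differentiable :: "('a::real_inner \<Rightarrow> real) \<Rightarrow> bool" where
  "twice_differentiable f \<longleftrightarrow>
     (\<forall>x. f differentiable (at x)) \<and> (\<forall>x. gradient f differentiable (at x))"

text \<open>The Hessian at a point, as the linear operator on the space that represents the second
  derivative through the inner product.\<close>

definition hessian :: "('a::real_inner \<Rightarrow> real) \<Rightarrow> 'a \<Rightarrow> 'a \<Rightarrow> 'a" where
  "hessian f x = frechet_derivative (gradient f) (at x)"

definition strongly_convex :: "real \<Rightarrow> ('a::real_inner \<Rightarrow> real) \<Rightarrow> bool" where
  "strongly_convex \<mu> f \<longleftrightarrow> (\<forall>x. f differentiable (at x)) \<and>
     (\<forall>x y. f y \<ge> f x + gradient f x \<bullet> (y - x) + \<mu> / 2 * (norm (x - y))\<^sup>2)"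

end

theory Submission
  imports Defs
begin

text \<open>
  Let \<open>a = \<alpha> / 2\<close>, let \<open>p\<close> be the minimiser and put \<open>v = x' + \<beta> \<nabla>f(x) + a (x - p)\<close>. The equation of
  motion becomes \<open>v' = - a v + a\<^sup>2 (x - p) - \<theta> \<nabla>f(x)\<close>, free of the Hessian. For the energy
  \<open>E = \<theta> (f(x) - f(p)) + \<parallel>v\<parallel>\<^sup>2 / 2\<close>, strong convexity and \<open>a\<^sup>2 \<le> \<mu> \<theta>\<close> yield
  \<open>E' + a E \<le> - \<beta> \<theta> \<parallel>\<nabla>f(x)\<parallel>\<^sup>2\<close>. Integrating \<open>(exp (a t) E)'\<close> gives both the decay and the integral
  bound; the initial velocity makes \<open>v(0) = a (x0 - p)\<close>, whence \<open>E(0) \<le> 2 \<theta> (f(x0) - f(p))\<close>.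
\<close>

text \<open>Monotone convergence for the truncations of \<open>h\<close> to
  \<open>{a..a + real n}\<close>: nonnegativity makes their integrals increase and \<open>B\<close>
  makes them converge. It turns a uniform bound on gauge integrals over compact intervals into
  Lebesgue integrability on the half-line.\<close>

lemma set_integrable_atLeast_if_integrals_bounded:
  fixes h :: "real \<Rightarrow> real"
  assumes cont: "continuous_on {a..} h"
    and nonneg: "\<And>t. t \<ge> a \<Longrightarrow> h t \<ge> 0"
    and bound: "\<And>t. t \<ge> a \<Longrightarrow> integral {a..t} h \<le> B"
  shows "set_integrable lborel {a..} h"
proof -
  define g where "g n t = indicator {a..a + real n} t *\<^sub>R h t" for n :: nat and t
  have ints: "set_integrable lborel {a..a + real n} h" for n :: nat
    by (rule borel_integrable_atLeastAtMost', rule continuous_on_subset[OF cont]) auto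
  have intg: "integrable lborel (g n)" for n
    using ints[of n] unfolding set_integrable_def g_def by simp
  have mono: "g m t \<le> g n t" if "m \<le> n" for m n t
    using that nonneg[of t] by (auto simp: g_def indicator_def)
  have "integral\<^sup>L lborel (g n) = integral {a..a + real n} h" for n
    using set_borel_integral_eq_integral(2)[OF ints[of n]]
    unfolding set_lebesgue_integral_def g_def by simp
  hence le: "integral\<^sup>L lborel (g n) \<le> B" for n
    using bound[of "a + real n"] by simp
  have "incseq (\<lambda>n. integral\<^sup>L lborel (g n))"
    by (auto intro!: incseq_SucI integral_mono intg mono)
  then obtain L where L: "(\<lambda>n. integral\<^sup>L lborel (g n)) \<longlonglongrightarrow> L"
    using incseq_convergent[of _ B] le by blast
  \<comment> \<open>For fixed \<open>t\<close> the sequence is constant as soon as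
    \<open>n \<ge> t - a\<close>.\<close>
  have lim: "(\<lambda>n. g n t) \<longlonglongrightarrow> indicator {a..} t *\<^sub>R h t" for t
  proof (rule tendsto_eventually)
    obtain N :: nat where "t - a \<le> real N" using real_arch_simple by blast
    hence "g n t = indicator {a..} t *\<^sub>R h t" if "n \<ge> N" for n
      using that by (auto simp: g_def indicator_def)
    thus "\<forall>\<^sub>F n in sequentially. g n t = indicator {a..} t *\<^sub>R h t"
      using eventually_sequentially by blast
  qed
  have meas: "(\<lambda>t. indicator {a..} t *\<^sub>R h t) \<in> borel_measurable lborel"
    using borel_measurable_continuous_on_indicator[OF _ cont] by simp
  show ?thesis
    unfolding set_integrable_def
    by (rule integrable_monotone_convergence[OF intg _ _ L meas])
       (use lim in \<open>auto simp: incseq_def intro!: AE_I2 mono\<close>)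
qed

lemma gradient_eq_0_if_minimum:
  fixes f :: "'a::{real_inner, complete_space} \<Rightarrow> real"
  assumes "f differentiable (at p)" and "\<And>y. f p \<le> f y"
  shows "gradient f p = 0"
proof -
  have "(f has_derivative (\<lambda>h. h \<bullet> gradient f p)) (at p)"
    using GDERIV_gradient[OF assms(1)] by (simp add: gderiv_def)
  hence "(\<lambda>h. h \<bullet> gradient f p) = (\<lambda>h. 0)"
    by (rule has_derivative_local_min) (use assms(2) in simp)
  thus ?thesis by (metis inner_eq_zero_iff)
qed

theorem theorem2:
  fixes f :: "'a::{real_inner, complete_space} \<Rightarrow> real"
    and x x' x'' :: "real \<Rightarrow> 'a"
    and x0 v0 :: 'a
    and fstar \<mu> \<theta> \<alpha> \<beta> \<gamma> :: real
  assumes "\<mu> > 0" and "strongly_convex \<mu> f" and "twice_differentiable f"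
    and "fstar \<in> range f" and "\<And>y. fstar \<le> f y"
    and "\<theta> > 0" and "\<alpha> \<in> {0<..2 * sqrt (\<mu> * \<theta>)}" and "\<beta> > 0"
    and "\<gamma> = \<theta> + 1 / 2 * \<alpha> * \<beta>"
    and "\<And>t. t \<ge> 0 \<Longrightarrow> (x has_vector_derivative x' t) (at t within {0..})"
    and "\<And>t. t \<ge> 0 \<Longrightarrow> (x' has_vector_derivative x'' t) (at t within {0..})"
    and "\<And>t. t \<ge> 0 \<Longrightarrow>
           x'' t + \<alpha> *\<^sub>R x' t + \<beta> *\<^sub>R hessian f (x t) (x' t) + \<gamma> *\<^sub>R gradient f (x t) = 0"
    and "x 0 = x0" and "x' 0 = v0"
    and "v0 = - \<beta> *\<^sub>R gradient f x0"
  shows "(\<forall>t\<ge>0. f (x t) - fstar \<le> 2 * (f x0 - fstar) * exp (- (1 / 2) * \<alpha> * t)) \<and>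
         set_integrable lborel {0..} (\<lambda>t. exp (\<alpha> / 2 * t) * (norm (gradient f (x t)))\<^sup>2)"
proof -
  define a where "a = \<alpha> / 2"
  define g where "g t = gradient f (x t)" for t
  obtain p where p: "f p = fstar" using assms(4) by auto
  define z where "z t = x t - p" for t
  define v where "v t = x' t + \<beta> *\<^sub>R g t + a *\<^sub>R z t" for t
  define E where "E t = \<theta> * (f (x t) - fstar) + (v t \<bullet> v t) / 2" for t
  define v' where "v' t = - a *\<^sub>R v t + (a * a) *\<^sub>R z t - \<theta> *\<^sub>R g t" for t
  define E' where "E' t = \<theta> * (x' t \<bullet> g t) + v t \<bullet> v' t" for t
  define W' where "W' t = exp (a * t) * (a * E t + E' t)" for t
  define h where "h t = exp (a * t) * (norm (g t))\<^sup>2" for t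
  have a: "a > 0" using assms(7) by (simp add: a_def)
  have \<gamma>: "\<gamma> = \<theta> + a * \<beta>" using assms(9) by (simp add: a_def)
  \<comment> \<open>The upper bound on \<open>\<alpha>\<close> is used in the form
    \<open>a * a \<le> \<mu> * \<theta>\<close>, both for the dissipation estimate and for the
    initial energy.\<close>
  have "a \<le> sqrt (\<mu> * \<theta>)" using assms(7) by (simp add: a_def)
  hence "a\<^sup>2 \<le> (sqrt (\<mu> * \<theta>))\<^sup>2" using a by (intro power_mono) auto
  hence a2: "a * a \<le> \<mu> * \<theta>" using assms(1,6) by (simp add: power2_eq_square)
  have df: "f differentiable (at y)" and dg: "gradient f differentiable (at y)" for y
    using assms(3) by (auto simp: twice_differentiable_def)
  have sc: "f y \<ge> f w + gradient f w \<bullet> (y - w) + \<mu> / 2 * (norm (w - y))\<^sup>2" for w y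
    using assms(2) by (simp add: strongly_convex_def)
  \<comment> \<open>Strong convexity based at the minimiser, where the gradient vanishes.\<close>
  have growth: "\<mu> / 2 * (z t \<bullet> z t) \<le> f (x t) - fstar" for t
    using sc[of p "x t"] gradient_eq_0_if_minimum[OF df, of p] assms(5) p
    by (simp add: z_def power2_norm_eq_inner norm_minus_commute[of p])
  \<comment> \<open>The same inequality based at \<open>x t\<close> and evaluated at
    \<open>p\<close>.\<close>
  have conv: "f (x t) - fstar + \<mu> / 2 * (z t \<bullet> z t) \<le> g t \<bullet> z t" for t
    using sc[of "x t" p] p by (simp add: z_def g_def power2_norm_eq_inner inner_diff_right)

  have dx: "(x has_derivative (\<lambda>s. s *\<^sub>R x' t)) (at t within {0..})" if "t \<ge> 0" for t
    using assms(10)[OF that] by (simp add: has_vector_derivative_def)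
  \<comment> \<open>By the chain rule the Hessian term of the equation is the time derivative of
    \<open>g\<close>, which is why \<open>v\<close> contains
    \<open>\<beta> *\<^sub>R g t\<close>.\<close>
  have dgx: "(g has_vector_derivative hessian f (x t) (x' t)) (at t within {0..})"
    if "t \<ge> 0" for t
  proof -
    have D: "(gradient f has_derivative hessian f (x t)) (at (x t))"
      using dg[of "x t"] unfolding hessian_def by (simp flip: frechet_derivative_works)
    then interpret H: bounded_linear "hessian f (x t)" by (rule has_derivative_bounded_linear)
    show ?thesis
      using has_derivative_compose[OF dx[OF that] D]
      by (simp add: has_vector_derivative_def g_def[abs_def] H.scaleR)
  qed
  have dfx: "((\<lambda>t. f (x t)) has_real_derivative x' t \<bullet> g t) (at t within {0..})"
    if "t \<ge> 0" for t
  proof -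
    have "(f has_derivative (\<lambda>h. h \<bullet> gradient f (x t))) (at (x t))"
      using GDERIV_gradient[OF df] by (simp add: gderiv_def)
    from has_derivative_compose[OF dx[OF that] this] show ?thesis
      by (simp add: has_field_derivative_def g_def mult_commute_abs)
  qed
  have dv: "(v has_vector_derivative v' t) (at t within {0..})" if t: "t \<ge> 0" for t
  proof -
    have "(v has_vector_derivative x'' t + \<beta> *\<^sub>R hessian f (x t) (x' t) + a *\<^sub>R x' t)
      (at t within {0..})"
      unfolding v_def[abs_def] z_def
      by (auto intro!: derivative_eq_intros assms(10,11) dgx t)
    moreover have "x'' t + \<beta> *\<^sub>R hessian f (x t) (x' t) = - \<alpha> *\<^sub>R x' t - \<gamma> *\<^sub>R g t"
      unfolding eq_iff_diff_eq_0[of "x'' t + _"] g_def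
      using assms(12)[OF t] by (simp add: algebra_simps)
    \<comment> \<open>Substituting \<open>x' = v - \<beta> g - a z\<close> into
      \<open>- a x'\<close> produces \<open>a \<beta> g\<close>, which cancels the part
      \<open>a * \<beta>\<close> of \<open>\<gamma>\<close> and leaves only
      \<open>\<theta>\<close>.\<close>
    moreover have "- \<alpha> *\<^sub>R x' t - \<gamma> *\<^sub>R g t + a *\<^sub>R x' t = v' t"
    proof -
      have \<alpha>: "\<alpha> = a + a" by (simp add: a_def)
      show ?thesis unfolding v'_def v_def \<gamma> \<alpha>
        by (simp only: scaleR_left_distrib scaleR_right_distrib scaleR_scaleR
              scaleR_minus_left minus_add_distrib) (simp add: algebra_simps)
    qed
    ultimately show ?thesis by simp
  qed
  have dE: "(E has_real_derivative E' t) (at t within {0..})" if t: "t \<ge> 0" for t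
  proof -
    have "((\<lambda>s. v s \<bullet> v s) has_derivative (\<lambda>s. v t \<bullet> (s *\<^sub>R v' t) + (s *\<^sub>R v' t) \<bullet> v t))
        (at t within {0..})"
      using dv[OF t] unfolding has_vector_derivative_def by (intro has_derivative_inner)
    hence "((\<lambda>s. v s \<bullet> v s) has_real_derivative 2 * (v t \<bullet> v' t)) (at t within {0..})"
      unfolding has_field_derivative_def
      by (rule has_derivative_eq_rhs) (auto simp: inner_commute algebra_simps)
    thus ?thesis unfolding E_def[abs_def] E'_def
      by (auto intro!: derivative_eq_intros dfx t)
  qed
  have dW: "((\<lambda>t. exp (a * t) * E t) has_real_derivative W' t) (at t within {0..})"
    if "t \<ge> 0" for t
    unfolding W'_def by (auto intro!: derivative_eq_intros dE that simp: algebra_simps)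

  have dissip: "E' t + a * E t \<le> - (\<beta> * \<theta>) * (norm (g t))\<^sup>2" for t
  proof -
    have x': "x' t = v t - \<beta> *\<^sub>R g t - a *\<^sub>R z t" by (simp add: v_def)
    have E': "E' t = - (a * \<theta>) * (g t \<bullet> z t) - \<beta> * \<theta> * (g t \<bullet> g t)
        - a * (v t \<bullet> v t) + a * a * (v t \<bullet> z t)"
      unfolding E'_def v'_def x'
      by (simp add: inner_diff inner_add inner_commute algebra_simps)
    \<comment> \<open>This replaces the mixed term \<open>g t \<bullet> z t\<close>: the part with
      \<open>f\<close> cancels the potential part of \<open>a * E t\<close>, and a negative multiple
      of \<open>z t \<bullet> z t\<close> is left over.\<close>
    have "a * \<theta> * (f (x t) - fstar + \<mu> / 2 * (z t \<bullet> z t)) \<le> a * \<theta> * (g t \<bullet> z t)"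
      using conv[of t] a assms(6) by (intro mult_left_mono) auto
    \<comment> \<open>Young's inequality, weighted so that its \<open>v\<close>-part cancels exactly
      the \<open>- a / 2 * (v t \<bullet> v t)\<close> remaining in \<open>E' t + a * E t\<close>.
      Its \<open>z\<close>-part is absorbed by the leftover from strong convexity.\<close>
    moreover have "0 \<le> a / 2 * ((v t - a *\<^sub>R z t) \<bullet> (v t - a *\<^sub>R z t))" using a by simp
    hence "a * a * (v t \<bullet> z t) \<le> a / 2 * (v t \<bullet> v t) + a / 2 * (a * a * (z t \<bullet> z t))"
      by (simp add: inner_diff inner_commute algebra_simps)
    moreover have "a / 2 * (a * a * (z t \<bullet> z t)) \<le> a / 2 * (\<mu> * \<theta> * (z t \<bullet> z t))"
      using a a2 by (intro mult_left_mono mult_right_mono) auto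
    ultimately show ?thesis
      unfolding E' E_def power2_norm_eq_inner by (simp add: algebra_simps)
  qed
  have W'_le: "W' t \<le> - (\<beta> * \<theta>) * h t" for t
    using mult_left_mono[OF dissip[of t], of "exp (a * t)"]
    by (simp add: W'_def h_def algebra_simps)

  have h0: "h t \<ge> 0" for t by (simp add: h_def)
  have "continuous_on {0..} g"
    by (rule continuous_on_vector_derivative) (use dgx in auto)
  hence cont: "continuous_on {0..} h"
    unfolding h_def[abs_def] by (intro continuous_intros)
  have bt: "\<beta> * \<theta> > 0" using assms(6,8) by simp
  have E0: "E t \<ge> \<theta> * (f (x t) - fstar)" "\<theta> * (f (x t) - fstar) \<ge> 0" for t
    using assms(5,6) by (simp_all add: E_def)
  \<comment> \<open>Integration of \<open>W'_le\<close> over \<open>{0..t}\<close>. Dropping the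
    integral gives the decay; dropping the energy gives the integral bound.\<close>
  have main: "exp (a * t) * E t + \<beta> * \<theta> * integral {0..t} h \<le> E 0" if t: "t \<ge> 0" for t
  proof -
    have "(W' has_integral exp (a * t) * E t - exp (a * 0) * E 0) {0..t}"
      using t
      by (intro fundamental_theorem_of_calculus)
         (auto simp flip: has_real_derivative_iff_has_vector_derivative
               intro: DERIV_subset[OF dW])
    moreover have "h integrable_on {0..t}"
      by (intro integrable_continuous_real continuous_on_subset[OF cont]) auto
    hence "((\<lambda>s. - (\<beta> * \<theta>) * h s) has_integral - (\<beta> * \<theta>) * integral {0..t} h) {0..t}"
      by (intro has_integral_mult_right integrable_integral)
    ultimately have "exp (a * t) * E t - exp (a * 0) * E 0 \<le> - (\<beta> * \<theta>) * integral {0..t} h"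
      by (rule has_integral_le) (rule W'_le)
    thus ?thesis by simp
  qed

  \<comment> \<open>The prescribed \<open>v0\<close> cancels \<open>\<beta> *\<^sub>R g 0\<close>.
    Then \<open>growth\<close> bounds the kinetic part of \<open>E 0\<close> by its potential part,
    whence the factor 2.\<close>
  have "v 0 = a *\<^sub>R z 0" using assms(13-15) by (simp add: v_def g_def)
  hence "v 0 \<bullet> v 0 = a * a * (z 0 \<bullet> z 0)" by simp
  also have "\<dots> \<le> \<mu> * \<theta> * (z 0 \<bullet> z 0)" using a2 by (intro mult_right_mono) auto
  also have "\<dots> = 2 * \<theta> * (\<mu> / 2 * (z 0 \<bullet> z 0))" by simp
  also have "\<dots> \<le> 2 * \<theta> * (f x0 - fstar)"
    using growth[of 0] assms(6,13) by (intro mult_left_mono) auto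
  finally have init: "E 0 \<le> 2 * \<theta> * (f x0 - fstar)" using assms(13) by (simp add: E_def)

  have "f (x t) - fstar \<le> 2 * (f x0 - fstar) * exp (- (1 / 2) * \<alpha> * t)" if t: "t \<ge> 0" for t
  proof -
    have "integral {0..t} h \<ge> 0" by (rule Henstock_Kurzweil_Integration.integral_nonneg)
        (auto intro!: h0 integrable_continuous_real continuous_on_subset[OF cont])
    hence "exp (a * t) * E t \<le> E 0" using main[OF t] bt by (smt (verit) mult_nonneg_nonneg)
    moreover have "exp (a * t) * (\<theta> * (f (x t) - fstar)) \<le> exp (a * t) * E t"
      using E0(1) by (intro mult_left_mono) auto
    ultimately have "\<theta> * (exp (a * t) * (f (x t) - fstar)) \<le> \<theta> * (2 * (f x0 - fstar))"
      using init by (simp add: algebra_simps)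
    hence "exp (a * t) * (f (x t) - fstar) \<le> 2 * (f x0 - fstar)"
      using assms(6) by simp
    hence "f (x t) - fstar \<le> 2 * (f x0 - fstar) * exp (- (a * t))"
      by (simp add: exp_minus field_simps)
    thus ?thesis by (simp add: a_def)
  qed
  moreover have "set_integrable lborel {0..} h"
  proof (rule set_integrable_atLeast_if_integrals_bounded[OF cont h0])
    fix t :: real assume t: "t \<ge> 0"
    have "exp (a * t) * E t \<ge> 0" using E0[of t] by simp
    \<comment> \<open>The bound does not depend on \<open>t\<close>, as the integrability criterion
      requires.\<close>
    thus "integral {0..t} h \<le> E 0 / (\<beta> * \<theta>)"
      using main[OF t] bt by (simp add: field_simps)
  qed
  ultimately show ?thesis by (simp add: h_def[abs_def] a_def g_def)
qed

end
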